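(* Let $f:\mathbb{R}^n\to\mathbb{R}$ be $L$-smooth and $\mu$-strongly convex with $L>\mu>0$, let $g:\mathbb{R}^n\to(-\infty,\infty]$ be closed, proper and convex, let $F=f+g$, let $x^\star$ be the unique minimizer of $F$ and $F^\star=F(x^\star)$. Let $\{x_k\}$ and $\{y_k\}$ be the sequences generated by the gradient restarted APG method (see context) with step size $0<s<1/L$. Assume the restart intervals $\{K_i\}_{i\ge1}$ (see context) are uniformly bounded from above by some integer $\overline{\mathcal K}\ge2$. Then there exists a positive constant $\hat\rho$ with $$0<\hat\rho<\rho:=1-\frac{(1-Ls)\mu s}{3}$$ such that $$\|x_k-x^\star\|^2\le(1-\mu s)\hat\rho^{\,k-1}\|x_0-x^\star\|^2\qquad\text{for all }k\ge1.$$ Moreover, the sequences $\{y_k\}$ and $\{F(x_k)\}$ also converge R-linearly with the same rate, i.e. there is a constant $C$ such that $\|y_k-x^\star\|^2\le C\hat\rho^{\,k}$ and $F(x_k)-F^\star\le C\hat\rho^{\,k}$ for all $k\ge1$.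
   Context: $\|\cdot\|$ is the Euclidean norm. $f$ is $L$-smooth if it is differentiable with $L$-Lipschitz gradient; $f$ is $\mu$-strongly convex if $f-\frac{\mu}{2}\|\cdot\|^2$ is convex. Proximal map: $\mathrm{prox}_{sg}(y)=\arg\min_{z\in\mathbb{R}^n}\{\frac12\|y-z\|^2+s\,g(z)\}$. Gradient restarted APG method. Input: initial point $x_0=y_0\in\mathbb{R}^n$, step size $s>0$, counter $j=1$, and a sequence $\{t_k\}_{k\ge1}$ with $t_1=1$, $t_{k+1}>t_k$, $t_k\to\infty$ and $t_{k+1}^2-t_{k+1}\le t_k^2$ for all $k\ge1$. For $k=1,2,\dots$: (i) set $z_k=\mathrm{prox}_{sg}(y_{k-1}-s\nabla f(y_{k-1}))$ and $y_k=z_k+\frac{t_j-1}{t_{j+1}}(z_k-x_{k-1})$; (ii) if $\langle z_k-x_{k-1},\,y_{k-1}-z_k\rangle>0$ (restart), set instead $x_k=\mathrm{prox}_{sg}(x_{k-1}-s\nabla f(x_{k-1}))$, $y_k=x_k$, and reset $j\leftarrow1$; (iii) otherwise set $x_k=z_k$ (keeping $y_k$ from (i)) and $j\leftarrow j+1$. Restart intervals: $S_0=0$; for $i\ge1$, $S_i$ is the total number of iterations completed before the $i$-th restart (i.e. the $i$-th iteration index $k$ at which the restart test in (ii) holds is $k=S_i+1$), and $K_i=S_i-S_{i-1}$ is the number of iterations in the $i$-th restart interval. Uniform boundedness of $\{K_i\}_{i\ge 1}$ by $\overline{\mathcal K}$ means that infinitely many restarts occur and $K_i\le\overline{\mathcal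 K}$ for all $i\ge1$. *)

theory Defs
  imports "HOL-Analysis.Analysis"
begin

definition grad :: "('a::euclidean_space \<Rightarrow> real) \<Rightarrow> 'a \<Rightarrow> 'a" where
  "grad f x = (THE D. GDERIV f x :> D)"

lemma grad_eqI:
  assumes "GDERIV f x :> D"
  shows "grad f x = D"
  unfolding grad_def
proof (rule the_equality)
  fix E assume "GDERIV f x :> E"
  then have "(\<lambda>h. h \<bullet> E) = (\<lambda>h. h \<bullet> D)"
    using assms unfolding gderiv_def by (rule has_derivative_unique)
  then show "E = D"
    by (auto simp: fun_eq_iff intro: euclidean_eqI[where x = E] simp: inner_commute)
qed (rule assms)

lemma GDERIV_grad:
  assumes "f differentiable (at x)"
  shows "GDERIV f x :> grad f x"
proof -
  obtain f' where f': "(f has_derivative f') (at x)"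
    using assms by (auto simp: differentiable_def)
  then interpret bounded_linear f'
    by (rule has_derivative_bounded_linear)
  have "f' = (\<lambda>h. h \<bullet> adjoint f' 1)"
    using adjoint_works[OF linear_axioms, of _ 1] by (intro ext) simp
  with f' have "GDERIV f x :> adjoint f' 1"
    unfolding gderiv_def by simp
  then show ?thesis
    by (simp add: grad_eqI)
qed

definition L_smooth :: "real \<Rightarrow> ('a::euclidean_space \<Rightarrow> real) \<Rightarrow> bool" where
  "L_smooth L f \<longleftrightarrow> (\<forall>x. f differentiable (at x)) \<and> L-lipschitz_on UNIV (grad f)"

definition strongly_convex :: "real \<Rightarrow> ('a::euclidean_space \<Rightarrow> real) \<Rightarrow> bool" where
  "strongly_convex \<mu> f \<longleftrightarrow> convex_on UNIV (\<lambda>x. f x - \<mu> / 2 * (norm x)\<^sup>2)"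

text \<open>The library's epigraph is for real-valued functions only.\<close>

definition ereal_epigraph :: "('a \<Rightarrow> ereal) \<Rightarrow> ('a \<times> real) set" where
  "ereal_epigraph g = {(x, r). g x \<le> ereal r}"

definition proper_fun :: "('a \<Rightarrow> ereal) \<Rightarrow> bool" where
  "proper_fun g \<longleftrightarrow> (\<forall>x. g x \<noteq> - \<infinity>) \<and> (\<exists>x. g x \<noteq> \<infinity>)"

definition closed_fun :: "('a::euclidean_space \<Rightarrow> ereal) \<Rightarrow> bool" where
  "closed_fun g \<longleftrightarrow> closed (ereal_epigraph g)"

definition convex_fun :: "('a::euclidean_space \<Rightarrow> ereal) \<Rightarrow> bool" where
  "convex_fun g \<longleftrightarrow> convex (ereal_epigraph g)"

text \<open>Here \<open>h\<close> stands for the scaled function \<open>s g\<close>. The minimizer exists and is unique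
  whenever \<open>h\<close> is closed, proper and convex.\<close>

definition prox :: "('a::euclidean_space \<Rightarrow> ereal) \<Rightarrow> 'a \<Rightarrow> 'a" where
  "prox h y = arg_min (\<lambda>z. ereal (1 / 2 * (norm (y - z))\<^sup>2) + h z) (\<lambda>_. True)"

definition prox_grad ::
  "('a::euclidean_space \<Rightarrow> real) \<Rightarrow> ('a \<Rightarrow> ereal) \<Rightarrow> real \<Rightarrow> 'a \<Rightarrow> 'a" where
  "prox_grad f g s y = prox (\<lambda>z. ereal s * g z) (y - s *\<^sub>R grad f y)"

definition momentum_seq :: "(nat \<Rightarrow> real) \<Rightarrow> bool" where
  "momentum_seq t \<longleftrightarrow> t 1 = 1 \<and> (\<forall>k\<ge>1. t k < t (k + 1)) \<and> filterlim t at_top sequentially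
     \<and> (\<forall>k\<ge>1. (t (k + 1))\<^sup>2 - t (k + 1) \<le> (t k)\<^sup>2)"

text \<open>The restart test on \<open>x = x\<^bsub>k-1\<^esub>\<close>, \<open>y = y\<^bsub>k-1\<^esub>\<close>.\<close>

definition restart_test ::
  "('a::euclidean_space \<Rightarrow> real) \<Rightarrow> ('a \<Rightarrow> ereal) \<Rightarrow> real \<Rightarrow> 'a \<Rightarrow> 'a \<Rightarrow> bool" where
  "restart_test f g s x y \<longleftrightarrow>
     (let z = prox_grad f g s y in (z - x) \<bullet> (y - z) > 0)"

text \<open>The state after \<open>k\<close> iterations is \<open>(x\<^sub>k, y\<^sub>k, j)\<close>, with \<open>j\<close> the counter
  to be used in iteration \<open>k + 1\<close>.\<close>

primrec apg_state ::
  "('a::euclidean_space \<Rightarrow> real) \<Rightarrow> ('a \<Rightarrow> ereal) \<Rightarrow> real \<Rightarrow> (nat \<Rightarrow> real) \<Rightarrow> 'a \<Rightarrow>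
     nat \<Rightarrow> 'a \<times> 'a \<times> nat" where
  "apg_state f g s t x0 0 = (x0, x0, 1)"
| "apg_state f g s t x0 (Suc k) =
     (case apg_state f g s t x0 k of (x, y, j) \<Rightarrow>
        if restart_test f g s x y
        then (let x' = prox_grad f g s x in (x', x', 1))
        else (let z = prox_grad f g s y
              in (z, z + ((t j - 1) / t (j + 1)) *\<^sub>R (z - x), j + 1)))"

definition apg_x ::
  "('a::euclidean_space \<Rightarrow> real) \<Rightarrow> ('a \<Rightarrow> ereal) \<Rightarrow> real \<Rightarrow> (nat \<Rightarrow> real) \<Rightarrow> 'a \<Rightarrow> nat \<Rightarrow> 'a" where
  "apg_x f g s t x0 k = fst (apg_state f g s t x0 k)"

definition apg_y ::
  "('a::euclidean_space \<Rightarrow> real) \<Rightarrow> ('a \<Rightarrow> ereal) \<Rightarrow> real \<Rightarrow> (nat \<Rightarrow> real) \<Rightarrow> 'a \<Rightarrow> nat \<Rightarrow> 'a" where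
  "apg_y f g s t x0 k = fst (snd (apg_state f g s t x0 k))"

definition restart_iters ::
  "('a::euclidean_space \<Rightarrow> real) \<Rightarrow> ('a \<Rightarrow> ereal) \<Rightarrow> real \<Rightarrow> (nat \<Rightarrow> real) \<Rightarrow> 'a \<Rightarrow> nat set" where
  "restart_iters f g s t x0 =
     {k. k \<ge> 1 \<and> restart_test f g s (apg_x f g s t x0 (k - 1)) (apg_y f g s t x0 (k - 1))}"

text \<open>\<open>R\<close> is an infinite set of restart iterations (all \<open>\<ge> 1\<close>). Since \<open>enumerate\<close> counts from
  \<open>0\<close>, the \<open>i\<close>-th restart is iteration \<open>enumerate R (i - 1)\<close>, and it comes after
  \<open>enumerate R (i - 1) - 1\<close> completed iterations.\<close>

fun restart_S :: "nat set \<Rightarrow> nat \<Rightarrow> nat" where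
  "restart_S R 0 = 0"
| "restart_S R (Suc i) = enumerate R i - 1"

definition restart_K :: "nat set \<Rightarrow> nat \<Rightarrow> nat" where
  "restart_K R i = restart_S R i - restart_S R (i - 1)"

definition restart_intervals_bounded :: "nat set \<Rightarrow> nat \<Rightarrow> bool" where
  "restart_intervals_bounded R K \<longleftrightarrow> infinite R \<and> (\<forall>i\<ge>1. restart_K R i \<le> K)"

end

theory Submission
  imports Defs
begin

text \<open>Put \<open>q = \<mu> s\<close>,
  \<open>\<delta> = 1 - L s\<close>, \<open>a = 2 s (F x - F x\<^sup>\<star>)\<close>, \<open>T = t\<^sub>j\<close> and \<open>w = T (y - x\<^sup>\<star>) - (T - 1) (x - x\<^sup>\<star>)\<close>.
  Strong convexity, together with the gradient-step residual (which bounds the gap from above),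
  shows that \<open>(1 + \<delta> q) T (T - 1) a + \<parallel>w\<parallel>\<^sup>2\<close> decreases by the factor \<open>\<rho> = 1 / (1 + \<delta> q)\<close> in each
  iteration.  As the new iterate is the convex combination of the old one and \<open>x\<^sup>\<star> + w'\<close>, with \<open>w'\<close>
  the new \<open>w\<close>, and as \<open>a \<ge> q \<parallel>x - x\<^sup>\<star>\<parallel>\<^sup>2\<close>, the same geometric bound passes to
  \<open>\<parallel>x - x\<^sup>\<star>\<parallel>\<^sup>2\<close>.  A restart is one proximal gradient step, which contracts by \<open>1 - q \<le> \<rho>\<close>.\<close>

section \<open>Quadratic bounds from smoothness and strong convexity\<close>

lemma GDERIV_along_line:
  fixes f :: "'a::euclidean_space \<Rightarrow> real"
  assumes "GDERIV f (y + r *\<^sub>R d) :> D"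
  shows "((\<lambda>r. f (y + r *\<^sub>R d)) has_real_derivative D \<bullet> d) (at r)"
proof -
  have "((\<lambda>r. y + r *\<^sub>R d) has_derivative (\<lambda>h. h *\<^sub>R d)) (at r)"
    by (auto intro!: derivative_eq_intros)
  moreover have "(f has_derivative (\<lambda>h. h \<bullet> D)) (at (y + r *\<^sub>R d))"
    using assms by (simp add: gderiv_def)
  ultimately have "((\<lambda>r. f (y + r *\<^sub>R d)) has_derivative (\<lambda>h. (h *\<^sub>R d) \<bullet> D)) (at r)"
    by (rule has_derivative_compose)
  then show ?thesis
    unfolding has_field_derivative_def
    by (rule back_subst[where P = "\<lambda>f'. (_ has_derivative f') _"])
       (auto simp: inner_commute)
qed

text \<open>No integral is used: the defect along the segment from \<open>y\<close> to
  \<open>z\<close> has a nonpositive derivative, by Cauchy-Schwarz and the Lipschitz bound on the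
  gradient.\<close>

lemma L_smooth_descent:
  assumes "L_smooth L f"
  shows "f z \<le> f y + grad f y \<bullet> (z - y) + L / 2 * (norm (z - y))\<^sup>2"
proof -
  define d where "d = z - y"
  define \<phi> where
    "\<phi> r = f (y + r *\<^sub>R d) - r * (grad f y \<bullet> d) - L / 2 * r\<^sup>2 * (norm d)\<^sup>2" for r
  have "\<phi> 1 \<le> \<phi> 0"
  proof (rule DERIV_nonpos_imp_nonincreasing[of 0 1 \<phi>])
    fix r :: real
    assume r: "0 \<le> r" "r \<le> 1"
    have "GDERIV f (y + r *\<^sub>R d) :> grad f (y + r *\<^sub>R d)"
      using assms by (auto simp: L_smooth_def intro: GDERIV_grad)
    then have "(\<phi> has_real_derivative
        (grad f (y + r *\<^sub>R d) \<bullet> d - grad f y \<bullet> d - L * r * (norm d)\<^sup>2)) (at r)"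
      unfolding \<phi>_def by (auto intro!: derivative_eq_intros GDERIV_along_line)
    moreover have "grad f (y + r *\<^sub>R d) \<bullet> d - grad f y \<bullet> d - L * r * (norm d)\<^sup>2 \<le> 0"
    proof -
      have "dist (grad f (y + r *\<^sub>R d)) (grad f y) \<le> L * dist (y + r *\<^sub>R d) y"
        using assms by (auto simp: L_smooth_def intro: lipschitz_onD)
      then have "norm (grad f (y + r *\<^sub>R d) - grad f y) \<le> L * r * norm d"
        using r by (simp add: dist_norm)
      then have "norm (grad f (y + r *\<^sub>R d) - grad f y) * norm d \<le> L * r * norm d * norm d"
        by (rule mult_right_mono) simp
      moreover have "(grad f (y + r *\<^sub>R d) - grad f y) \<bullet> d
          \<le> norm (grad f (y + r *\<^sub>R d) - grad f y) * norm d"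
        by (rule norm_cauchy_schwarz)
      ultimately show ?thesis
        by (simp add: inner_diff_left power2_eq_square mult.assoc)
    qed
    ultimately show "\<exists>D. (\<phi> has_real_derivative D) (at r) \<and> D \<le> 0"
      by blast
  qed simp
  then show ?thesis
    by (simp add: \<phi>_def d_def)
qed

lemma strongly_convexD:
  assumes "strongly_convex m f" and "0 \<le> r" "r \<le> 1"
  shows "f (p + r *\<^sub>R (x - p))
    \<le> (1 - r) * f p + r * f x - m / 2 * r * (1 - r) * (norm (x - p))\<^sup>2"
proof -
  define u where "u = (1 - r) *\<^sub>R p + r *\<^sub>R x"
  have "f u - m / 2 * (norm u)\<^sup>2
    \<le> (1 - r) * (f p - m / 2 * (norm p)\<^sup>2) + r * (f x - m / 2 * (norm x)\<^sup>2)"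
    using assms convex_onD[of UNIV "\<lambda>x. f x - m / 2 * (norm x)\<^sup>2" r p x]
    by (simp add: strongly_convex_def u_def)
  moreover have "m / 2 * (norm u)\<^sup>2
    = m / 2 * ((1 - r) * (norm p)\<^sup>2 + r * (norm x)\<^sup>2 - r * (1 - r) * (norm (x - p))\<^sup>2)"
    unfolding power2_norm_eq_inner u_def
    by (simp add: inner_simps inner_commute[of x p]) (simp add: algebra_simps)
  ultimately have "f u \<le> (1 - r) * (f p - m / 2 * (norm p)\<^sup>2)
      + r * (f x - m / 2 * (norm x)\<^sup>2)
      + m / 2 * ((1 - r) * (norm p)\<^sup>2 + r * (norm x)\<^sup>2 - r * (1 - r) * (norm (x - p))\<^sup>2)"
    by linarith
  also have "\<dots> = (1 - r) * f p + r * f x - m / 2 * r * (1 - r) * (norm (x - p))\<^sup>2"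
    by (simp add: algebra_simps diff_divide_distrib add_divide_distrib)
  also have "u = p + r *\<^sub>R (x - p)"
    by (simp add: u_def algebra_simps)
  finally show ?thesis .
qed

text \<open>Letting \<open>r\<close> tend to 0 removes the factor \<open>1 - r\<close> that survives
  division by \<open>r\<close> in \<open>strongly_convex_minimizer\<close>.\<close>

lemma le_by_scaled_limit:
  fixes A B C :: real
  assumes "\<And>r. 0 < r \<Longrightarrow> r < 1 \<Longrightarrow> A + (1 - r) * C \<le> B"
  shows "A + C \<le> B"
proof (rule tendsto_upperbound)
  show "((\<lambda>r. A + (1 - r) * C) \<longlongrightarrow> A + C) (at_right 0)"
    by (auto intro!: tendsto_eq_intros)
  show "\<forall>\<^sub>F r in at_right 0. A + (1 - r) * C \<le> B"
    using assms by (intro eventually_at_rightI[of 0 1]) auto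
qed simp

text \<open>\<open>\<phi>\<close> is a difference quotient plus the strong convexity term. It stays
  below \<open>f x - f y\<close>, and its limit at 0 is the claim.\<close>

lemma strongly_convex_above_tangent:
  assumes "strongly_convex m f" and "GDERIV f y :> D"
  shows "f y + D \<bullet> (x - y) + m / 2 * (norm (x - y))\<^sup>2 \<le> f x"
proof -
  define \<phi> where "\<phi> r = (f (y + r *\<^sub>R (x - y)) - f y) / r + (1 - r) * (m / 2 * (norm (x - y))\<^sup>2)" for r
  have "((\<lambda>r. f (y + r *\<^sub>R (x - y))) has_real_derivative D \<bullet> (x - y)) (at 0)"
    using assms(2) by (intro GDERIV_along_line) simp
  then have "((\<lambda>r. (f (y + r *\<^sub>R (x - y)) - f y) / r) \<longlongrightarrow> D \<bullet> (x - y)) (at 0)"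
    by (simp add: DERIV_def)
  then have "((\<lambda>r. (f (y + r *\<^sub>R (x - y)) - f y) / r) \<longlongrightarrow> D \<bullet> (x - y)) (at_right 0)"
    by (rule filterlim_mono) (auto simp: at_le)
  then have "(\<phi> \<longlongrightarrow> D \<bullet> (x - y) + (1 - 0) * (m / 2 * (norm (x - y))\<^sup>2)) (at_right 0)"
    unfolding \<phi>_def by (intro tendsto_intros)
  moreover have "\<forall>\<^sub>F r in at_right 0. \<phi> r \<le> f x - f y"
  proof -
    have "\<phi> r \<le> f x - f y" if "0 < r" "r < 1" for r
    proof -
      have "f (y + r *\<^sub>R (x - y)) - f y
        \<le> r * (f x - f y - (1 - r) * (m / 2 * (norm (x - y))\<^sup>2))"
        using strongly_convexD[OF assms(1), of r y x] that by (simp add: algebra_simps)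
      then have "(f (y + r *\<^sub>R (x - y)) - f y) / r
        \<le> f x - f y - (1 - r) * (m / 2 * (norm (x - y))\<^sup>2)"
        using that by (simp add: divide_le_eq mult.commute)
      then show ?thesis
        by (simp add: \<phi>_def)
    qed
    then show ?thesis
      by (intro eventually_at_rightI[of 0 1]) auto
  qed
  ultimately have "D \<bullet> (x - y) + (1 - 0) * (m / 2 * (norm (x - y))\<^sup>2) \<le> f x - f y"
    by (intro tendsto_upperbound[of \<phi> _ "at_right 0"]) auto
  then show ?thesis
    by simp
qed

text \<open>The set \<open>E\<close> stands for the epigraph of the nonsmooth term, whose values
  thus enter as real heights without extended-real arithmetic. It is applied to \<open>f\<close>
  over the epigraph of \<open>g\<close>, and to the prox objective over that of
  \<open>s g\<close>.\<close>

lemma strongly_convex_minimizer: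
  assumes "strongly_convex m h" and "convex E"
    and "(p, \<gamma>) \<in> E" "(x, \<xi>) \<in> E"
    and min: "\<And>u \<upsilon>. (u, \<upsilon>) \<in> E \<Longrightarrow> h p + \<gamma> \<le> h u + \<upsilon>"
  shows "h p + \<gamma> + m / 2 * (norm (x - p))\<^sup>2 \<le> h x + \<xi>"
proof (rule le_by_scaled_limit)
  fix r :: real
  assume r: "0 < r" "r < 1"
  have "(1 - r) *\<^sub>R (p, \<gamma>) + r *\<^sub>R (x, \<xi>) \<in> E"
    using assms r by (intro convexD) auto
  moreover have "(1 - r) *\<^sub>R (p, \<gamma>) + r *\<^sub>R (x, \<xi>) = (p + r *\<^sub>R (x - p), (1 - r) * \<gamma> + r * \<xi>)"
    by (simp add: algebra_simps)
  ultimately have "h p + \<gamma> \<le> h (p + r *\<^sub>R (x - p)) + ((1 - r) * \<gamma> + r * \<xi>)"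
    by (intro min) simp
  also have "\<dots> \<le> (1 - r) * h p + r * h x - m / 2 * r * (1 - r) * (norm (x - p))\<^sup>2
      + ((1 - r) * \<gamma> + r * \<xi>)"
    using strongly_convexD[OF assms(1), of r p x] r by simp
  finally have "r * (h p + \<gamma> + (1 - r) * (m / 2 * (norm (x - p))\<^sup>2)) \<le> r * (h x + \<xi>)"
    by (simp add: algebra_simps)
  then show "h p + \<gamma> + (1 - r) * (m / 2 * (norm (x - p))\<^sup>2) \<le> h x + \<xi>"
    using r by simp
qed

lemma convex_on_affine: "convex_on UNIV (\<lambda>z. c - v \<bullet> z :: real)"
proof (rule convex_onI)
  fix r :: real and x y
  show "c - v \<bullet> ((1 - r) *\<^sub>R x + r *\<^sub>R y) \<le> (1 - r) * (c - v \<bullet> x) + r * (c - v \<bullet> y)"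
    by (simp add: inner_add_right) (simp add: algebra_simps)
qed simp

lemma strongly_convex_dist_square: "strongly_convex 1 (\<lambda>z. 1 / 2 * (norm (v - z))\<^sup>2)"
proof -
  have "1 / 2 * (norm (v - z))\<^sup>2 - 1 / 2 * (norm z)\<^sup>2 = 1 / 2 * (norm v)\<^sup>2 - v \<bullet> z" for z
    unfolding power2_norm_eq_inner
    by (simp add: inner_simps inner_commute[of z v] diff_divide_distrib add_divide_distrib)
  then show ?thesis
    by (simp only: strongly_convex_def convex_on_affine)
qed

section \<open>One-step estimates in an inner product space\<close>

text \<open>After a translation \<open>x\<^sup>\<star> = 0\<close>; \<open>q\<close>, \<open>\<delta>\<close>, \<open>a\<close> stand for \<open>\<mu> s\<close>, \<open>1 - L s\<close> and
  \<open>2 s (F x - F x\<^sup>\<star>)\<close>.  The term \<open>\<delta> T\<^sup>2 \<parallel>z - y\<parallel>\<^sup>2\<close>, which the usual FISTA estimate discards, is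
  what pays for the factor \<open>1 + \<delta> q\<close>.\<close>

lemma lyapunov_step:
  fixes x y z :: "'a::real_inner" and a a' q \<delta> T :: real
  assumes "0 < q" "q \<le> 1" "0 \<le> \<delta>" "1 \<le> T"
    and prev: "T = 1 \<or> a' \<le> a + 2 * ((y - z) \<bullet> (z - x)) + (1 - \<delta>) * (norm (z - y))\<^sup>2 - q * (norm (x - y))\<^sup>2"
    and opt: "a' \<le> 2 * ((y - z) \<bullet> z) + (1 - \<delta>) * (norm (z - y))\<^sup>2 - q * (norm y)\<^sup>2"
  shows "(1 + \<delta> * q) * T\<^sup>2 * a' + (norm (T *\<^sub>R z - (T - 1) *\<^sub>R x))\<^sup>2
    \<le> T * (T - 1) * a + (1 - q) * (norm (T *\<^sub>R y - (T - 1) *\<^sub>R x))\<^sup>2"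
proof -
  \<comment> \<open>Weight \<open>T * (T - 1)\<close> goes to the inequality at \<open>x\<close> and
    \<open>T\<close> to the one at the minimizer, \<open>T\<^sup>2\<close> in total. The first
    weight vanishes at \<open>T = 1\<close>, a case that covers a starting point outside the domain
    of \<open>g\<close>.\<close>
  have "T * (T - 1) * a' \<le> T * (T - 1) * (a + 2 * ((y - z) \<bullet> (z - x)) + (1 - \<delta>) * (norm (z - y))\<^sup>2 - q * (norm (x - y))\<^sup>2)"
    using prev \<open>1 \<le> T\<close> by (cases "T = 1") (auto intro!: mult_left_mono)
  moreover have "T * a' \<le> T * (2 * ((y - z) \<bullet> z) + (1 - \<delta>) * (norm (z - y))\<^sup>2 - q * (norm y)\<^sup>2)"
    using opt \<open>1 \<le> T\<close> by (intro mult_left_mono) auto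
  moreover have "T * (T - 1) * (a + 2 * ((y - z) \<bullet> (z - x)) + (1 - \<delta>) * (norm (z - y))\<^sup>2 - q * (norm (x - y))\<^sup>2)
      + T * (2 * ((y - z) \<bullet> z) + (1 - \<delta>) * (norm (z - y))\<^sup>2 - q * (norm y)\<^sup>2)
    = T * (T - 1) * a + (1 - q) * (norm (T *\<^sub>R y - (T - 1) *\<^sub>R x))\<^sup>2
      - (norm (T *\<^sub>R z - (T - 1) *\<^sub>R x))\<^sup>2 - \<delta> * T\<^sup>2 * (norm (z - y))\<^sup>2 - q * (T - 1) * (norm x)\<^sup>2"
    unfolding power2_norm_eq_inner
    by (simp add: inner_simps inner_commute[of y x] inner_commute[of z x] inner_commute[of z y])
       (simp add: algebra_simps power2_eq_square)
  ultimately have "T * (T - 1) * a' + T * a' \<le> T * (T - 1) * a + (1 - q) * (norm (T *\<^sub>R y - (T - 1) *\<^sub>R x))\<^sup>2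
      - (norm (T *\<^sub>R z - (T - 1) *\<^sub>R x))\<^sup>2 - \<delta> * T\<^sup>2 * (norm (z - y))\<^sup>2 - q * (T - 1) * (norm x)\<^sup>2"
    by linarith
  moreover have "0 \<le> q * (T - 1) * (norm x)\<^sup>2"
    using \<open>0 < q\<close> \<open>1 \<le> T\<close> by simp
  moreover have "\<delta> * T\<^sup>2 * (q * a') \<le> \<delta> * T\<^sup>2 * (norm (z - y))\<^sup>2"
  proof (rule mult_left_mono)
    have "q * a' \<le> q * (2 * ((y - z) \<bullet> z) + (1 - \<delta>) * (norm (z - y))\<^sup>2 - q * (norm y)\<^sup>2)"
      using opt \<open>0 < q\<close> by (intro mult_left_mono) auto
    \<comment> \<open>Completing the square exhibits the residual as an upper bound for
      \<open>q * a'\<close>.\<close>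
    also have "\<dots> = (norm (z - y))\<^sup>2 - q * (1 + \<delta>) * (norm (z - y))\<^sup>2 - (norm (y - z - q *\<^sub>R y))\<^sup>2"
      unfolding power2_norm_eq_inner
      by (simp add: inner_simps inner_commute[of z y]) (simp add: algebra_simps)
    also have "\<dots> \<le> (norm (z - y))\<^sup>2"
    proof -
      have "0 \<le> q * (1 + \<delta>) * (norm (z - y))\<^sup>2"
        using \<open>0 < q\<close> \<open>0 \<le> \<delta>\<close> by simp
      then show ?thesis
        using zero_le_power2[of "norm (y - z - q *\<^sub>R y)"] by linarith
    qed
    finally show "q * a' \<le> (norm (z - y))\<^sup>2" .
  qed (use \<open>0 \<le> \<delta>\<close> in simp)
  ultimately show ?thesis
    by (simp add: algebra_simps power2_eq_square)
qed

text \<open>Convexity of the squared norm, multiplied by \<open>T\<close>: \<open>u\<close> is the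
  mean of \<open>x\<close> and \<open>T *\<^sub>R u - (T - 1) *\<^sub>R x\<close> with weights
  \<open>(T - 1) / T\<close> and \<open>1 / T\<close>.\<close>

lemma norm_square_convex_combination:
  fixes x u :: "'a::real_inner"
  assumes "1 \<le> T"
  shows "T * (norm u)\<^sup>2 \<le> (T - 1) * (norm x)\<^sup>2 + (norm (T *\<^sub>R u - (T - 1) *\<^sub>R x))\<^sup>2"
proof -
  have "(T - 1) * (norm x)\<^sup>2 + (norm (T *\<^sub>R u - (T - 1) *\<^sub>R x))\<^sup>2
    = T * (norm u)\<^sup>2 + T * (T - 1) * (norm (u - x))\<^sup>2"
    unfolding power2_norm_eq_inner
    by (simp add: inner_simps inner_commute[of u x]) (simp add: algebra_simps)
  then show ?thesis
    using assms by simp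
qed

lemma momentum_seqD:
  assumes "momentum_seq t" and "1 \<le> k"
  shows "1 \<le> t k" and "(t (k + 1))\<^sup>2 - t (k + 1) \<le> (t k)\<^sup>2"
proof -
  show "1 \<le> t k"
    using \<open>1 \<le> k\<close>
  proof (induction k rule: dec_induct)
    case (step n)
    then have "t n < t (n + 1)"
      using assms(1) by (simp add: momentum_seq_def)
    then show ?case
      using step by simp
  qed (use assms(1) in \<open>simp add: momentum_seq_def\<close>)
qed (use assms in \<open>simp add: momentum_seq_def\<close>)

section \<open>The composite objective and its growth at the minimizer\<close>

locale composite_problem =
  fixes f :: "'a::euclidean_space \<Rightarrow> real" and g :: "'a \<Rightarrow> ereal"
    and L \<mu> s :: real and xstar :: 'a
  assumes mu_pos: "0 < \<mu>" and mu_less: "\<mu> < L" and s_pos: "0 < s" and Ls_less: "L * s < 1"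
    and smooth: "L_smooth L f" and strong: "strongly_convex \<mu> f"
    and closed_g: "closed_fun g" and proper_g: "proper_fun g" and convex_g: "convex_fun g"
    and xstar_min: "is_arg_min (\<lambda>z. ereal (f z) + g z) (\<lambda>_. True) xstar"
begin

text \<open>Takes the default value 0 where \<open>g\<close> is infinite, so it is meaningful only
  together with finiteness of \<open>g\<close>; the same holds for \<open>gap\<close>.\<close>

definition gr :: "'a \<Rightarrow> real" where
  "gr z = real_of_ereal (g z)"

definition gap :: "'a \<Rightarrow> real" where
  "gap z = 2 * s * (f z + gr z - f xstar - gr xstar)"

lemma g_eq_ereal: "g z \<noteq> \<infinity> \<Longrightarrow> g z = ereal (gr z)"
  using proper_g by (cases "g z") (auto simp: gr_def proper_fun_def)

lemma in_epigraph: "g z \<noteq> \<infinity> \<Longrightarrow> (z, gr z) \<in> ereal_epigraph g"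
  by (simp add: ereal_epigraph_def flip: g_eq_ereal)

lemma epigraph_finite: "(z, r) \<in> ereal_epigraph g \<Longrightarrow> g z \<noteq> \<infinity> \<and> gr z \<le> r"
  using proper_g by (cases "g z") (auto simp: ereal_epigraph_def gr_def proper_fun_def)

lemma xstar_le: "ereal (f xstar) + g xstar \<le> ereal (f z) + g z"
  using xstar_min by (auto simp: is_arg_min_linorder)

lemma g_xstar_finite: "g xstar \<noteq> \<infinity>"
proof -
  obtain z where "g z \<noteq> \<infinity>"
    using proper_g unfolding proper_fun_def by blast
  then have "ereal (f z) + g z < \<infinity>"
    by (cases "g z") auto
  then have "ereal (f xstar) + g xstar < \<infinity>"
    by (rule le_less_trans[OF xstar_le])
  then show ?thesis
    by (cases "g xstar") auto
qed

text \<open>Optimality of \<open>xstar\<close> in the real-valued form that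
  \<open>strongly_convex_minimizer\<close> expects.\<close>

lemma epigraph_optimal:
  assumes "(z, r) \<in> ereal_epigraph g"
  shows "f xstar + gr xstar \<le> f z + r"
proof -
  have z: "g z \<noteq> \<infinity>" "gr z \<le> r"
    using epigraph_finite[OF assms] by auto
  then show ?thesis
    using xstar_le[of z] by (simp add: g_eq_ereal[OF g_xstar_finite] g_eq_ereal[OF z(1)])
qed

lemma gap_growth:
  assumes "g z \<noteq> \<infinity>"
  shows "\<mu> * s * (norm (z - xstar))\<^sup>2 \<le> gap z"
proof -
  have "f xstar + gr xstar + \<mu> / 2 * (norm (z - xstar))\<^sup>2 \<le> f z + gr z"
    using strong convex_g epigraph_optimal
    by (intro strongly_convex_minimizer[where E = "ereal_epigraph g"])
       (auto simp: convex_fun_def in_epigraph g_xstar_finite assms)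
  then have "2 * s * (\<mu> / 2 * (norm (z - xstar))\<^sup>2) \<le> 2 * s * (f z + gr z - f xstar - gr xstar)"
    using s_pos by (intro mult_left_mono) auto
  then show ?thesis
    by (simp add: gap_def mult_ac)
qed

section \<open>The proximal gradient step\<close>

text \<open>Since \<open>F\<close> is bounded below by \<open>F x\<^sup>\<star>\<close> and \<open>s L < 1\<close>, the prox objective at a gradient step
  is coercive.\<close>

lemma prox_objective_coercive:
  assumes "(z, r) \<in> ereal_epigraph g"
  shows "s * (f xstar + gr xstar - f y) + s\<^sup>2 / 2 * (norm (grad f y))\<^sup>2 + (1 - L * s) / 2 * (norm (z - y))\<^sup>2
    \<le> 1 / 2 * (norm (y - s *\<^sub>R grad f y - z))\<^sup>2 + s * r"
proof -
  have "f xstar + gr xstar \<le> f y + grad f y \<bullet> (z - y) + L / 2 * (norm (z - y))\<^sup>2 + r"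
    using epigraph_optimal[OF assms] L_smooth_descent[OF smooth, of z y] by linarith
  then have "s * (f xstar + gr xstar) \<le> s * (f y + grad f y \<bullet> (z - y) + L / 2 * (norm (z - y))\<^sup>2 + r)"
    using s_pos by (intro mult_left_mono) auto
  moreover have "(norm (y - s *\<^sub>R grad f y - z))\<^sup>2
    = (norm (z - y))\<^sup>2 + 2 * s * (grad f y \<bullet> (z - y)) + s\<^sup>2 * (norm (grad f y))\<^sup>2"
  proof -
    define d where "d = z - y"
    have "norm (y - s *\<^sub>R grad f y - z) = norm (d + s *\<^sub>R grad f y)"
      unfolding d_def norm_minus_cancel[symmetric, of "z - y + _"] by (simp add: algebra_simps)
    then have "(norm (y - s *\<^sub>R grad f y - z))\<^sup>2 = (norm (d + s *\<^sub>R grad f y))\<^sup>2"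
      by simp
    also have "\<dots> = (norm d)\<^sup>2 + 2 * s * (grad f y \<bullet> d) + s\<^sup>2 * (norm (grad f y))\<^sup>2"
      unfolding power2_norm_eq_inner
      by (simp add: inner_add_left inner_add_right inner_commute[of d "grad f y"] power2_eq_square distrib_left)
    finally show ?thesis
      by (simp add: d_def)
  qed
  ultimately show ?thesis
    by (simp add: algebra_simps diff_divide_distrib add_divide_distrib)
qed

text \<open>\<open>prox\<close> is a choice of minimizer, so nothing can be derived from it before
  existence is known. Lifted to the epigraph, the objective is continuous, and coercivity makes its
  sublevel set compact.\<close>

lemma prox_objective_attained:
  obtains p where "is_arg_min
    (\<lambda>z. ereal (1 / 2 * (norm (y - s *\<^sub>R grad f y - z))\<^sup>2) + ereal s * g z) (\<lambda>_. True) p"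
proof -
  define v where "v = y - s *\<^sub>R grad f y"
  define obj where "obj = (\<lambda>(z, r). 1 / 2 * (norm (v - z))\<^sup>2 + s * r)"
  define c where "c = obj (xstar, gr xstar)"
  define S where "S = ereal_epigraph g \<inter> {w. obj w \<le> c}"
  have cont: "continuous_on A obj" for A
    unfolding obj_def case_prod_beta by (intro continuous_intros)
  have "closed {w. obj w \<le> c}"
    by (intro closed_Collect_le cont continuous_intros)
  then have "closed S"
    using closed_g by (simp add: S_def closed_fun_def closed_Int)
  moreover have "bounded S"
  proof -
    define c0 where "c0 = s * (f xstar + gr xstar - f y) + s\<^sup>2 / 2 * (norm (grad f y))\<^sup>2"
    \<comment> \<open>\<open>R\<close> comes from \<open>u \<le> 1 + u\<^sup>2\<close> and the
      coercive bound on the squared distance; \<open>b\<close> bounds the height \<open>r\<close>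
      from below by optimality and the descent inequality on the ball of radius
      \<open>R\<close>.\<close>
    define R where "R = 1 + 2 * (c - c0) / (1 - L * s)"
    define b where "b = f xstar + gr xstar - (f y + norm (grad f y) * R + L / 2 * R\<^sup>2)"
    have "S \<subseteq> cball y R \<times> {b..c / s}"
    proof safe
      fix z r
      assume "(z, r) \<in> S"
      then have epi: "(z, r) \<in> ereal_epigraph g" and obj: "1 / 2 * (norm (v - z))\<^sup>2 + s * r \<le> c"
        by (auto simp: S_def obj_def)
      have "(1 - L * s) * (norm (z - y))\<^sup>2 \<le> 2 * (c - c0)"
        using prox_objective_coercive[OF epi, of y] obj by (simp add: c0_def v_def)
      then have "(norm (z - y))\<^sup>2 \<le> 2 * (c - c0) / (1 - L * s)"
        using Ls_less by (simp add: field_simps)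
      moreover have "norm (z - y) \<le> 1 + (norm (z - y))\<^sup>2"
        using zero_le_power2[of "norm (z - y) - 1 / 2"]
        by (simp add: power2_eq_square algebra_simps)
      ultimately have R: "norm (z - y) \<le> R"
        by (simp add: R_def)
      then show "z \<in> cball y R"
        by (simp add: dist_norm norm_minus_commute)
      have "s * r \<le> c"
        using obj zero_le_power2[of "norm (v - z)"] by linarith
      then have "r \<le> c / s"
        using s_pos by (simp add: field_simps)
      moreover have "b \<le> r"
      proof -
        have "grad f y \<bullet> (z - y) \<le> norm (grad f y) * R"
          using norm_cauchy_schwarz[of "grad f y" "z - y"] R
            mult_left_mono[OF R, of "norm (grad f y)"] by simp
        moreover have "L / 2 * (norm (z - y))\<^sup>2 \<le> L / 2 * R\<^sup>2"
          using R mu_pos mu_less by (intro mult_left_mono power_mono) auto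
        ultimately show ?thesis
          using epigraph_optimal[OF epi] L_smooth_descent[OF smooth, of z y]
          by (simp add: b_def)
      qed
      ultimately show "r \<in> {b..c / s}"
        by simp
    qed
    then show ?thesis
      by (rule bounded_subset[rotated]) (intro bounded_Times bounded_cball bounded_closed_interval)
  qed
  ultimately have "compact S"
    by (simp add: compact_eq_bounded_closed)
  moreover have "(xstar, gr xstar) \<in> S"
    by (simp add: S_def c_def in_epigraph g_xstar_finite)
  ultimately obtain w where w: "w \<in> S" "\<And>u. u \<in> S \<Longrightarrow> obj w \<le> obj u"
    using continuous_attains_inf[OF _ _ cont] by (metis empty_iff)
  obtain p \<gamma> where [simp]: "w = (p, \<gamma>)"
    by fastforce
  \<comment> \<open>Points of the epigraph outside \<open>S\<close> have objective above
    \<open>c\<close>, hence above the minimum over \<open>S\<close>.\<close>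
  have min: "obj (p, \<gamma>) \<le> obj u" if "u \<in> ereal_epigraph g" for u
    using w that by (cases "u \<in> S") (auto simp: S_def)
  have "(p, \<gamma>) \<in> ereal_epigraph g"
    using w by (simp add: S_def)
  then have p: "g p \<noteq> \<infinity>" "gr p \<le> \<gamma>"
    using epigraph_finite by auto
  have "ereal (1 / 2 * (norm (v - p))\<^sup>2) + ereal s * g p
      \<le> ereal (1 / 2 * (norm (v - z))\<^sup>2) + ereal s * g z" for z
  proof (cases "g z = \<infinity>")
    case False
    have "s * gr p \<le> s * \<gamma>"
      using p s_pos by simp
    then show ?thesis
      using min[OF in_epigraph[OF False]]
      by (simp add: g_eq_ereal[OF False] g_eq_ereal[OF p(1)] obj_def)
  qed (use s_pos in simp)
  then show thesis
    using that[of p] unfolding is_arg_min_linorder v_def by simp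
qed

lemma prox_grad_le:
  "ereal (1 / 2 * (norm (y - s *\<^sub>R grad f y - prox_grad f g s y))\<^sup>2) + ereal s * g (prox_grad f g s y)
    \<le> ereal (1 / 2 * (norm (y - s *\<^sub>R grad f y - z))\<^sup>2) + ereal s * g z"
proof -
  define obj where
    "obj = (\<lambda>z. ereal (1 / 2 * (norm (y - s *\<^sub>R grad f y - z))\<^sup>2) + ereal s * g z)"
  obtain p where "is_arg_min obj (\<lambda>_. True) p"
    unfolding obj_def by (rule prox_objective_attained)
  then have "is_arg_min obj (\<lambda>_. True) (arg_min obj (\<lambda>_. True))"
    unfolding arg_min_def by (rule someI)
  moreover have "prox_grad f g s y = arg_min obj (\<lambda>_. True)"
    by (simp add: prox_grad_def prox_def obj_def)
  ultimately have "obj (prox_grad f g s y) \<le> obj z"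
    by (simp add: is_arg_min_linorder)
  then show ?thesis
    by (simp add: obj_def)
qed

lemma g_prox_grad_finite: "g (prox_grad f g s y) \<noteq> \<infinity>"
proof
  assume "g (prox_grad f g s y) = \<infinity>"
  then show False
    using prox_grad_le[of y xstar] s_pos g_eq_ereal[OF g_xstar_finite] by simp
qed

text \<open>The prox objective is 1-strongly convex; the quadratic term gained at its minimizer
  turns the difference of squares into an inner product.\<close>

lemma prox_grad_variational:
  assumes "g x \<noteq> \<infinity>"
  shows "s * gr (prox_grad f g s y) \<le> s * gr x
    + (y - s *\<^sub>R grad f y - prox_grad f g s y) \<bullet> (prox_grad f g s y - x)"
proof -
  define v where "v = y - s *\<^sub>R grad f y"
  define p where "p = prox_grad f g s y"
  have p: "g p \<noteq> \<infinity>"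
    by (simp add: p_def g_prox_grad_finite)
  \<comment> \<open>Scaling the heights by \<open>s\<close> gives the epigraph of
    \<open>s g\<close>.\<close>
  define E where "E = (\<lambda>(z, r). (z, s * r)) ` ereal_epigraph g"
  have "linear (\<lambda>(z :: 'a, r). (z, s * r))"
    by (auto simp: linear_iff algebra_simps)
  then have "convex E"
    using convex_g by (simp add: E_def convex_fun_def convex_linear_image)
  moreover have "1 / 2 * (norm (v - p))\<^sup>2 + s * gr p \<le> 1 / 2 * (norm (v - u))\<^sup>2 + \<upsilon>"
    if "(u, \<upsilon>) \<in> E" for u \<upsilon>
  proof -
    obtain r where r: "(u, r) \<in> ereal_epigraph g" "\<upsilon> = s * r"
      using \<open>(u, \<upsilon>) \<in> E\<close> by (auto simp: E_def)
    then have u: "g u \<noteq> \<infinity>" "gr u \<le> r"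
      using epigraph_finite by auto
    have "s * gr u \<le> s * r"
      using u s_pos by simp
    then show ?thesis
      using prox_grad_le[of y u] r
      by (simp add: g_eq_ereal[OF u(1)] g_eq_ereal[OF p] flip: p_def v_def)
  qed
  moreover have "(z, s * gr z) \<in> E" if "g z \<noteq> \<infinity>" for z
    using in_epigraph[OF that] by (auto simp: E_def)
  ultimately have "1 / 2 * (norm (v - p))\<^sup>2 + s * gr p + 1 / 2 * (norm (x - p))\<^sup>2
      \<le> 1 / 2 * (norm (v - x))\<^sup>2 + s * gr x"
    using p assms by (intro strongly_convex_minimizer[OF strongly_convex_dist_square]) auto
  moreover have "1 / 2 * (norm (v - x))\<^sup>2 - 1 / 2 * (norm (v - p))\<^sup>2 - 1 / 2 * (norm (x - p))\<^sup>2
      = (v - p) \<bullet> (p - x)"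
    unfolding power2_norm_eq_inner
    by (simp add: inner_simps inner_commute[of x p] inner_commute[of p v] inner_commute[of x v]
        diff_divide_distrib add_divide_distrib)
  ultimately have "s * gr p \<le> s * gr x + (v - p) \<bullet> (p - x)"
    by linarith
  then show ?thesis
    by (simp add: p_def v_def)
qed

text \<open>The descent inequality at \<open>p\<close> and the strong convexity bound at
  \<open>x\<close> are both expanded at \<open>y\<close>; their gradient terms cancel against those
  of the variational inequality.\<close>

lemma gap_prox_grad:
  fixes x y :: 'a
  assumes "g x \<noteq> \<infinity>"
  defines "p \<equiv> prox_grad f g s y"
  shows "gap p \<le> gap x + 2 * ((y - p) \<bullet> (p - x)) + L * s * (norm (p - y))\<^sup>2 - \<mu> * s * (norm (x - y))\<^sup>2"
proof -
  have "GDERIV f y :> grad f y"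
    using smooth by (auto simp: L_smooth_def intro: GDERIV_grad)
  then have "f p - f x \<le> grad f y \<bullet> (p - y) + L / 2 * (norm (p - y))\<^sup>2
      - grad f y \<bullet> (x - y) - \<mu> / 2 * (norm (x - y))\<^sup>2"
    using L_smooth_descent[OF smooth, of p y] strongly_convex_above_tangent[OF strong, of y _ x]
    by fastforce
  then have "2 * s * (f p - f x) \<le> 2 * s * (grad f y \<bullet> (p - y) + L / 2 * (norm (p - y))\<^sup>2
      - grad f y \<bullet> (x - y) - \<mu> / 2 * (norm (x - y))\<^sup>2)"
    using s_pos by (intro mult_left_mono) auto
  moreover have "s * gr p \<le> s * gr x + (y - s *\<^sub>R grad f y - p) \<bullet> (p - x)"
    unfolding p_def by (rule prox_grad_variational[OF assms(1)])
  moreover have "(y - s *\<^sub>R grad f y - p) \<bullet> (p - x)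
      = (y - p) \<bullet> (p - x) - s * (grad f y \<bullet> (p - y)) + s * (grad f y \<bullet> (x - y))"
    by (simp add: inner_simps algebra_simps)
  ultimately show ?thesis
    by (simp add: gap_def algebra_simps)
qed

lemma gap_prox_grad_xstar:
  fixes y :: 'a
  defines "p \<equiv> prox_grad f g s y"
  shows "gap p \<le> 2 * ((y - p) \<bullet> (p - xstar)) + L * s * (norm (p - y))\<^sup>2 - \<mu> * s * (norm (y - xstar))\<^sup>2"
  using gap_prox_grad[OF g_xstar_finite, of y]
  by (simp add: p_def gap_def[of xstar] norm_minus_commute[of xstar])

section \<open>The rate and the invariant of one iteration\<close>

definition \<rho> :: real where
  "\<rho> = 1 / (1 + (1 - L * s) * (\<mu> * s))"

lemma mus_less: "\<mu> * s < 1"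
  using mu_less s_pos Ls_less mult_strict_right_mono[OF mu_less s_pos] by linarith

text \<open>With \<open>u = \<delta> * q\<close> in (0,1),
  \<open>(1 - u / 3) * (1 + u) = 1 + u * (2 - u) / 3\<close> exceeds 1, which makes the second bound
  strict. The third uses \<open>\<delta> < 1\<close>.\<close>

lemma rho_props:
  "0 < \<rho>" "\<rho> < 1 - (1 - L * s) * \<mu> * s / 3" "1 - \<mu> * s \<le> \<rho>"
  "\<rho> * (1 + (1 - L * s) * (\<mu> * s)) = 1"
proof -
  define \<delta> q where "\<delta> = 1 - L * s" and "q = \<mu> * s"
  have q: "0 < q" "q < 1" and d: "0 < \<delta>" "\<delta> < 1"
    using mu_pos mu_less s_pos mus_less Ls_less by (auto simp: \<delta>_def q_def)
  have dq: "0 < \<delta> * q" "\<delta> * q < 1"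
    using q d mult_strict_mono[of \<delta> 1 q 1] by auto
  show "0 < \<rho>" and eq: "\<rho> * (1 + (1 - L * s) * (\<mu> * s)) = 1"
    using dq by (auto simp: \<rho>_def simp flip: \<delta>_def q_def)
  have "0 < \<delta> * q * (2 - \<delta> * q)"
    using dq by simp
  then have "1 < (1 - \<delta> * q / 3) * (1 + \<delta> * q)"
    by (simp add: algebra_simps)
  then have "\<rho> < 1 - \<delta> * q / 3"
    using dq by (simp add: \<rho>_def divide_less_eq flip: \<delta>_def q_def)
  then show "\<rho> < 1 - (1 - L * s) * \<mu> * s / 3"
    by (simp add: \<delta>_def q_def mult.assoc)
  have "(1 - q) * (1 + \<delta> * q) \<le> (1 - q) * (1 + q)"
    using q d by (intro mult_left_mono) auto
  also have "\<dots> \<le> 1"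
    by (simp add: algebra_simps)
  finally show "1 - \<mu> * s \<le> \<rho>"
    using dq by (simp add: \<rho>_def le_divide_eq flip: \<delta>_def q_def)
qed

lemma prox_grad_lyapunov:
  assumes "1 \<le> T" and "T = 1 \<or> g x \<noteq> \<infinity>"
  shows "(1 + (1 - L * s) * (\<mu> * s)) * T\<^sup>2 * gap (prox_grad f g s y)
      + (norm (T *\<^sub>R (prox_grad f g s y - xstar) - (T - 1) *\<^sub>R (x - xstar)))\<^sup>2
    \<le> T * (T - 1) * gap x
      + (1 - \<mu> * s) * (norm (T *\<^sub>R (y - xstar) - (T - 1) *\<^sub>R (x - xstar)))\<^sup>2"
  using assms mus_less mu_pos s_pos Ls_less gap_prox_grad[of x y] gap_prox_grad_xstar[of y]
  by (intro lyapunov_step) auto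

text \<open>The invariant, with \<open>T\<close> the current momentum parameter. Its weight
  \<open>T * (T - 1)\<close> vanishes at \<open>T = 1\<close>, so gap and distance are bounded
  separately: the gap for the rate of \<open>F\<close>, the distance for use at a restart.\<close>

definition bounded_state :: "real \<Rightarrow> real \<Rightarrow> 'a \<Rightarrow> 'a \<Rightarrow> bool" where
  "bounded_state B T x y \<longleftrightarrow> 1 \<le> T \<and> g x \<noteq> \<infinity> \<and> gap x \<le> B \<and> (norm (x - xstar))\<^sup>2 \<le> B \<and>
     (1 + (1 - L * s) * (\<mu> * s)) * (T * (T - 1)) * gap x
       + (norm (T *\<^sub>R (y - xstar) - (T - 1) *\<^sub>R (x - xstar)))\<^sup>2 \<le> B"

lemma gap_nonneg: "g z \<noteq> \<infinity> \<Longrightarrow> 0 \<le> gap z"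
  using gap_growth[of z] mu_pos s_pos
  by (meson mult_nonneg_nonneg less_imp_le order_trans zero_le_power2)

text \<open>The Lyapunov estimate with \<open>T = 1\<close> and \<open>y = x\<close>. The first
  claim serves restarts; the second keeps the gap term for the first iteration, where the counter
  moves on to 2.\<close>

lemma bounded_state_plain_step:
  assumes "(1 - \<mu> * s) * (norm (x - xstar))\<^sup>2 \<le> B"
  shows "bounded_state B 1 (prox_grad f g s x) (prox_grad f g s x)"
    and "(1 + (1 - L * s) * (\<mu> * s)) * gap (prox_grad f g s x) + (norm (prox_grad f g s x - xstar))\<^sup>2 \<le> B"
proof -
  define p where "p = prox_grad f g s x"
  have g: "g p \<noteq> \<infinity>"
    by (simp add: p_def g_prox_grad_finite)
  have le: "(1 + (1 - L * s) * (\<mu> * s)) * gap p + (norm (p - xstar))\<^sup>2 \<le> B"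
    using prox_grad_lyapunov[of 1 x x] assms by (simp add: p_def)
  then show "(1 + (1 - L * s) * (\<mu> * s)) * gap (prox_grad f g s x) + (norm (prox_grad f g s x - xstar))\<^sup>2 \<le> B"
    by (simp add: p_def)
  have "1 * gap p \<le> (1 + (1 - L * s) * (\<mu> * s)) * gap p"
    using gap_nonneg[OF g] mu_pos s_pos Ls_less by (intro mult_right_mono) auto
  then have "gap p \<le> B" "(norm (p - xstar))\<^sup>2 \<le> B"
    using le gap_nonneg[OF g] zero_le_power2[of "norm (p - xstar)"] by linarith+
  then show "bounded_state B 1 (prox_grad f g s x) (prox_grad f g s x)"
    using g by (simp add: bounded_state_def flip: p_def)
qed

lemma bounded_state_momentum_step:
  fixes x y :: 'a
  assumes T': "1 \<le> T'" "T'\<^sup>2 - T' \<le> T\<^sup>2"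
    and "bounded_state B T x y"
  defines "p \<equiv> prox_grad f g s y"
  shows "bounded_state (\<rho> * B) T' p (p + ((T - 1) / T') *\<^sub>R (p - x))"
proof -
  define \<kappa> where "\<kappa> = 1 + (1 - L * s) * (\<mu> * s)"
  have \<kappa>: "1 \<le> \<kappa>" "\<rho> * \<kappa> = 1"
    using mu_pos s_pos Ls_less rho_props(4) by (auto simp: \<kappa>_def)
  define w where "w = T *\<^sub>R (y - xstar) - (T - 1) *\<^sub>R (x - xstar)"
  define w' where "w' = T *\<^sub>R (p - xstar) - (T - 1) *\<^sub>R (x - xstar)"
  have T: "1 \<le> T" and gx: "g x \<noteq> \<infinity>" and xB: "(norm (x - xstar))\<^sup>2 \<le> B"
    and wB: "\<kappa> * (T * (T - 1)) * gap x + (norm w)\<^sup>2 \<le> B"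
    using assms(3) by (auto simp: bounded_state_def \<kappa>_def w_def)
  have gp: "g p \<noteq> \<infinity>"
    by (simp add: p_def g_prox_grad_finite)
  note gap_p = gap_nonneg[OF gp]
  have lyap: "\<kappa> * T\<^sup>2 * gap p + (norm w')\<^sup>2 \<le> \<rho> * B"
  proof -
    have "\<kappa> * T\<^sup>2 * gap p + (norm w')\<^sup>2 \<le> T * (T - 1) * gap x + (1 - \<mu> * s) * (norm w)\<^sup>2"
      using prox_grad_lyapunov[OF T, of x y] gx by (simp add: \<kappa>_def w_def w'_def p_def)
    \<comment> \<open>Inserting \<open>\<rho> * \<kappa> = 1\<close> lets \<open>\<rho>\<close>
      factor out of the gap term as well.\<close>
    also have "\<dots> \<le> (\<rho> * \<kappa>) * (T * (T - 1) * gap x) + \<rho> * (norm w)\<^sup>2"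
      using \<kappa> rho_props(3) by (simp add: mult_right_mono)
    also have "\<dots> = \<rho> * (\<kappa> * (T * (T - 1)) * gap x + (norm w)\<^sup>2)"
      by (simp add: algebra_simps)
    also have "\<dots> \<le> \<rho> * B"
      using wB rho_props(1) by simp
    finally show ?thesis .
  qed
  have gap_T: "gap p \<le> \<kappa> * T\<^sup>2 * gap p"
  proof -
    have "1 * 1 \<le> \<kappa> * T\<^sup>2"
      using \<kappa> T by (intro mult_mono) auto
    then show ?thesis
      using gap_p mult_right_mono[of 1 "\<kappa> * T\<^sup>2" "gap p"] by simp
  qed
  then have gapB: "gap p \<le> \<rho> * B"
    using lyap zero_le_power2[of "norm w'"] by linarith
  have pB: "(norm (p - xstar))\<^sup>2 \<le> \<rho> * B"
  \<comment> \<open>Convexity alone only bounds the distance by a mean of \<open>B\<close> and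
    \<open>\<rho> * B\<close>. If it exceeded \<open>\<rho> * B\<close>, quadratic growth would
    force a gap large enough to lower the bound on \<open>w'\<close> by
    \<open>\<mu> * s * T\<^sup>2 * B\<close>, which outweighs the excess
    \<open>(T - 1) * (1 - \<rho>) * B\<close>.\<close>
  proof (rule ccontr)
    assume "\<not> ?thesis"
    then have *: "\<rho> * B < (norm (p - xstar))\<^sup>2"
      by simp
    have "0 \<le> B"
      using xB zero_le_power2[of "norm (x - xstar)"] by linarith
    have "\<mu> * s * (\<rho> * B) \<le> gap p"
      using gap_growth[OF gp] * mu_pos s_pos
      by (meson less_imp_le mult_left_mono mult_nonneg_nonneg order_trans)
    then have "\<kappa> * T\<^sup>2 * (\<mu> * s * (\<rho> * B)) \<le> \<kappa> * T\<^sup>2 * gap p"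
      using \<kappa> by (intro mult_left_mono) auto
    moreover have "\<kappa> * T\<^sup>2 * (\<mu> * s * (\<rho> * B)) = (\<rho> * \<kappa>) * (\<mu> * s * T\<^sup>2 * B)"
      by (simp add: mult_ac)
    moreover have "T * (\<rho> * B) < T * (norm (p - xstar))\<^sup>2"
      using * T by simp
    moreover have "T * (norm (p - xstar))\<^sup>2 \<le> (T - 1) * (norm (x - xstar))\<^sup>2 + (norm w')\<^sup>2"
      unfolding w'_def by (rule norm_square_convex_combination[OF T])
    moreover have "(T - 1) * (norm (x - xstar))\<^sup>2 \<le> (T - 1) * B"
      using xB T by (intro mult_left_mono) auto
    ultimately have "T * (\<rho> * B) < (T - 1) * B + \<rho> * B - \<mu> * s * T\<^sup>2 * B"
      using lyap \<kappa> by simp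
    then have "0 < ((T - 1) * (1 - \<rho>) - \<mu> * s * T\<^sup>2) * B"
      by (simp add: algebra_simps)
    moreover have "(T - 1) * (1 - \<rho>) \<le> \<mu> * s * T\<^sup>2"
    proof -
      have "0 \<le> (1 - L * s) * \<mu> * s / 3"
        using mu_pos s_pos Ls_less by simp
      then have "\<rho> \<le> 1"
        using rho_props(2) by linarith
      then have "(T - 1) * (1 - \<rho>) \<le> T\<^sup>2 * (\<mu> * s)"
        using T rho_props(3) self_le_power[of T 2] by (intro mult_mono) auto
      then show ?thesis
        by (simp add: mult_ac)
    qed
    ultimately show False
      using \<open>0 \<le> B\<close> by (simp add: zero_less_mult_iff)
  qed
  \<comment> \<open>The momentum coefficient is exactly what turns \<open>w'\<close> into the vector
    \<open>w\<close> of the new state.\<close>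
  have "T' *\<^sub>R ((p + ((T - 1) / T') *\<^sub>R (p - x)) - xstar) - (T' - 1) *\<^sub>R (p - xstar) = w'"
  proof -
    define e where "e = ((T - 1) / T') *\<^sub>R (p - x)"
    have "T' *\<^sub>R e = (T - 1) *\<^sub>R (p - x)"
      using T' by (simp add: e_def)
    moreover have "T' *\<^sub>R (p + e - xstar) - (T' - 1) *\<^sub>R (p - xstar) = T' *\<^sub>R e + (p - xstar)"
      by (simp add: algebra_simps)
    ultimately show ?thesis
      unfolding e_def[symmetric] w'_def by (simp add: algebra_simps)
  qed
  moreover have "\<kappa> * (T' * (T' - 1)) * gap p \<le> \<kappa> * T\<^sup>2 * gap p"
    using T' \<kappa> gap_p by (intro mult_right_mono mult_left_mono) (auto simp: power2_eq_square algebra_simps)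
  ultimately show ?thesis
    using T' gp gapB pB lyap unfolding bounded_state_def \<kappa>_def by simp
qed

text \<open>\<open>y - xstar\<close> is a convex combination of \<open>x - xstar\<close> and the
  vector \<open>w\<close>, both with squared norm at most \<open>B\<close>.\<close>

lemma bounded_state_y:
  assumes "bounded_state B T x y"
  shows "(norm (y - xstar))\<^sup>2 \<le> B"
proof -
  have T: "1 \<le> T" and gx: "g x \<noteq> \<infinity>" and xB: "(norm (x - xstar))\<^sup>2 \<le> B"
    and wB: "(1 + (1 - L * s) * (\<mu> * s)) * (T * (T - 1)) * gap x
       + (norm (T *\<^sub>R (y - xstar) - (T - 1) *\<^sub>R (x - xstar)))\<^sup>2 \<le> B"
    using assms by (auto simp: bounded_state_def)
  have "0 \<le> (1 + (1 - L * s) * (\<mu> * s)) * (T * (T - 1)) * gap x"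
    using T gap_nonneg[OF gx] mu_pos s_pos Ls_less by (intro mult_nonneg_nonneg add_nonneg_nonneg) auto
  moreover have "(T - 1) * (norm (x - xstar))\<^sup>2 \<le> (T - 1) * B"
    using xB T by (intro mult_left_mono) auto
  ultimately have "T * (norm (y - xstar))\<^sup>2 \<le> T * B"
    using norm_square_convex_combination[OF T, of "y - xstar" "x - xstar"] wB
    by (simp add: algebra_simps)
  then show ?thesis
    using T by simp
qed

section \<open>Geometric decay along the iteration\<close>

text \<open>Every iteration, restarted or not, multiplies the bound by \<open>\<rho>\<close>, so a
  single induction covers all restart patterns. It starts after the first iteration, since
  \<open>g x0\<close> may be infinite.\<close>

lemma apg_state_bounded:
  assumes t: "momentum_seq t"
  shows "\<exists>x y j. apg_state f g s t x0 (Suc k) = (x, y, j) \<and> 1 \<le> j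
    \<and> bounded_state ((1 - \<mu> * s) * \<rho> ^ k * (norm (x0 - xstar))\<^sup>2) (t j) x y"
proof (induction k)
  case 0
  have t1: "t 1 = 1"
    using t by (simp add: momentum_seq_def)
  define p where "p = prox_grad f g s x0"
  define B where "B = (1 - \<mu> * s) * (norm (x0 - xstar))\<^sup>2"
  have le: "(1 + (1 - L * s) * (\<mu> * s)) * gap p + (norm (p - xstar))\<^sup>2 \<le> B"
    and p: "bounded_state B 1 p p"
    using bounded_state_plain_step[of x0 B] by (auto simp: p_def B_def)
  \<comment> \<open>With \<open>x = y\<close> the tested inner product is minus a squared norm, so
    the first iteration never restarts.\<close>
  have "\<not> restart_test f g s x0 x0"
    using inner_ge_zero[of "p - x0"]
    by (simp add: restart_test_def Let_def inner_diff inner_commute flip: p_def)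
  then have "apg_state f g s t x0 (Suc 0) = (p, p, 2)"
    using t1 by (simp add: p_def Let_def)
  \<comment> \<open>As \<open>t 1 = 1\<close>, there is no momentum yet and \<open>y = p\<close>.
    The bound \<open>t 2 * (t 2 - 1) \<le> 1\<close> lets the sharper plain-step estimate absorb the
    new gap weight.\<close>
  moreover have "bounded_state B (t 2) p p"
  proof -
    have "(t 2)\<^sup>2 - t 2 \<le> 1"
      using momentum_seqD(2)[OF t order_refl] unfolding t1 one_add_one by simp
    then have "t 2 * (t 2 - 1) \<le> 1" "1 \<le> t 2"
      using momentum_seqD(1)[OF t, of 2] by (auto simp: power2_eq_square algebra_simps)
    moreover have "0 \<le> (1 + (1 - L * s) * (\<mu> * s)) * gap p"
      using gap_nonneg[OF g_prox_grad_finite, of x0] mu_pos s_pos Ls_less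
      by (simp add: p_def)
    ultimately have "(1 + (1 - L * s) * (\<mu> * s)) * gap p * (t 2 * (t 2 - 1))
        \<le> (1 + (1 - L * s) * (\<mu> * s)) * gap p"
      by (simp add: mult_left_le)
    then show ?thesis
      using p le \<open>1 \<le> t 2\<close>
      by (simp add: bounded_state_def mult_ac flip: scaleR_diff_left)
  qed
  ultimately show ?case
    by (auto simp: B_def)
next
  case (Suc k)
  then obtain x y j where st: "apg_state f g s t x0 (Suc k) = (x, y, j)" and "1 \<le> j"
    and b: "bounded_state ((1 - \<mu> * s) * \<rho> ^ k * (norm (x0 - xstar))\<^sup>2) (t j) x y"
    by blast
  define B where "B = (1 - \<mu> * s) * \<rho> ^ k * (norm (x0 - xstar))\<^sup>2"
  have B: "(1 - \<mu> * s) * \<rho> ^ Suc k * (norm (x0 - xstar))\<^sup>2 = \<rho> * B"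
    by (simp add: B_def)
  show ?case
  proof (cases "restart_test f g s x y")
    case True
    \<comment> \<open>A restart discards \<open>w\<close> and uses only the distance bound, together
      with \<open>1 - \<mu> * s \<le> \<rho>\<close>.\<close>
    have "(1 - \<mu> * s) * (norm (x - xstar))\<^sup>2 \<le> \<rho> * B"
      using b rho_props mus_less by (intro mult_mono) (auto simp: bounded_state_def B_def)
    then have "bounded_state (\<rho> * B) (t 1) (prox_grad f g s x) (prox_grad f g s x)"
      using bounded_state_plain_step(1) t by (simp add: momentum_seq_def)
    then show ?thesis
      unfolding B using st True by (simp add: Let_def)
  next
    case False
    have "bounded_state (\<rho> * B) (t (j + 1)) (prox_grad f g s y)
        (prox_grad f g s y + ((t j - 1) / t (j + 1)) *\<^sub>R (prox_grad f g s y - x))"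
      using momentum_seqD[OF t, of j] momentum_seqD[OF t, of "j + 1"] \<open>1 \<le> j\<close> b
      by (intro bounded_state_momentum_step) (auto simp: B_def)
    then show ?thesis
      unfolding B using st False by (simp add: Let_def)
  qed
qed

end

theorem proposition2:
  fixes f :: "real ^ 'n \<Rightarrow> real" and g F :: "real ^ 'n \<Rightarrow> ereal"
    and L \<mu> s :: real and t :: "nat \<Rightarrow> real"
    and x y :: "nat \<Rightarrow> real ^ 'n" and x0 xstar :: "real ^ 'n" and Kbar :: nat
  assumes "0 < \<mu>" and "\<mu> < L"
    and "L_smooth L f" and "strongly_convex \<mu> f"
    and "closed_fun g" and "proper_fun g" and "convex_fun g"
    and "\<And>z. F z = ereal (f z) + g z"
    and "is_arg_min F (\<lambda>_. True) xstar"
    and "0 < s" and "s < 1 / L"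
    and "momentum_seq t"
    and "\<And>k. x k = apg_x f g s t x0 k"
    and "\<And>k. y k = apg_y f g s t x0 k"
    and "2 \<le> Kbar"
    and "restart_intervals_bounded (restart_iters f g s t x0) Kbar"
  shows "\<exists>\<rho>hat::real. 0 < \<rho>hat \<and> \<rho>hat < 1 - (1 - L * s) * \<mu> * s / 3
    \<and> (\<forall>k\<ge>1. (norm (x k - xstar))\<^sup>2 \<le> (1 - \<mu> * s) * \<rho>hat ^ (k - 1) * (norm (x0 - xstar))\<^sup>2)
    \<and> (\<exists>C::real. \<forall>k\<ge>1. (norm (y k - xstar))\<^sup>2 \<le> C * \<rho>hat ^ k
                    \<and> F (x k) - F xstar \<le> ereal (C * \<rho>hat ^ k))"
proof -
  have F: "F = (\<lambda>z. ereal (f z) + g z)"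
    using assms(8) by blast
  have Ls: "L * s < 1"
    using \<open>s < 1 / L\<close> \<open>0 < \<mu>\<close> \<open>\<mu> < L\<close> by (simp add: field_simps)
  interpret composite_problem f g L \<mu> s xstar
    using assms Ls by unfold_locales (auto simp: F)
  define B where "B k = (1 - \<mu> * s) * \<rho> ^ (k - 1) * (norm (x0 - xstar))\<^sup>2" for k :: nat
  have state: "\<exists>T. bounded_state (B k) T (x k) (y k)" if "1 \<le> k" for k
    using apg_state_bounded[OF \<open>momentum_seq t\<close>, of x0 "k - 1"] that
    by (auto simp: B_def assms(13,14) apg_x_def apg_y_def simp del: apg_state.simps)
  have xB: "(norm (x k - xstar))\<^sup>2 \<le> B k" if "1 \<le> k" for k
    using state[OF that] by (auto simp: bounded_state_def)
  have yB: "(norm (y k - xstar))\<^sup>2 \<le> B k" if "1 \<le> k" for k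
    using state[OF that] bounded_state_y by blast
  have FB: "F (x k) - F xstar \<le> ereal (B k / (2 * s))" if "1 \<le> k" for k
  proof -
    have gx: "g (x k) \<noteq> \<infinity>" and gap: "gap (x k) \<le> B k"
      using state[OF that] by (auto simp: bounded_state_def)
    have "f (x k) + gr (x k) - f xstar - gr xstar \<le> B k / (2 * s)"
      using gap s_pos by (simp add: gap_def field_simps)
    then show ?thesis
      by (simp add: F g_eq_ereal[OF gx] g_eq_ereal[OF g_xstar_finite])
  qed
  \<comment> \<open>Division by \<open>\<rho>\<close> shifts the exponent from \<open>k - 1\<close>
    to \<open>k\<close>; the maximum serves distances (factor 1) and function values (factor
    \<open>1 / (2 * s)\<close>) at once.\<close>
  define C where "C = (1 - \<mu> * s) * (norm (x0 - xstar))\<^sup>2 / \<rho> * max 1 (1 / (2 * s))"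
  have BC: "B k * max 1 (1 / (2 * s)) = C * \<rho> ^ k" if "1 \<le> k" for k
    using that rho_props(1) by (cases k) (auto simp: B_def C_def)
  have B0: "0 \<le> B k" for k
    using mus_less rho_props(1) by (simp add: B_def)
  have "B k \<le> C * \<rho> ^ k" "B k / (2 * s) \<le> C * \<rho> ^ k" if "1 \<le> k" for k
    using mult_left_mono[OF max.cobounded1 B0, of k 1 "1 / (2 * s)"]
      mult_left_mono[OF max.cobounded2 B0, of k "1 / (2 * s)" 1]
    by (auto simp flip: BC[OF that])
  then have "\<forall>k\<ge>1. (norm (y k - xstar))\<^sup>2 \<le> C * \<rho> ^ k \<and> F (x k) - F xstar \<le> ereal (C * \<rho> ^ k)"
    using yB FB by (meson ereal_less_eq(3) order_trans)
  then show ?thesis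
    using rho_props(1,2) xB unfolding B_def by blast
qed

end
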